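(* For every $k\in\mathbb{N}$ there exist connected graphs $G$, $H$ and permutations $\pi:V_G\to V_G$, $\sigma:V_H\to V_H$ such that $\gamma_{wcon}(G)-\gamma_{wcon}(\pi G)\ge k$ and $\gamma_{wcon}(\sigma H)-2\gamma_{wcon}(H)\ge k$.
   Context: Graphs are finite, simple, undirected and nonempty. For a graph $G$ with vertex set $V_G$ and a permutation $\pi$ of $V_G$, let $G'$ be a vertex-disjoint copy of $G$, with $v'$ the copy of $v$. The prism graph $\pi G$ has vertex set $V_G\cup V_{G'}$ and edge set $E_G\cup E_{G'}\cup\{u\,\pi(u)':u\in V_G\}$. A set $A$ of vertices is dominating if every vertex of the graph is in $A$ or adjacent to a vertex of $A$. In a connected graph, $A$ is weakly convex if for every $u,v\in A$ it contains all vertices of at least one shortest $u$--$v$ path of the graph. $\gamma_{wcon}$ denotes the minimum cardinality of a weakly convex dominating set. *)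

theory Defs
  imports "Graph_Theory.Graph_Theory" "HOL-Combinatorics.Permutations"
begin

text \<open>
  A finite simple undirected graph is a \<open>pair_graph\<close>: a finite, loop-free, symmetric digraph whose
  arcs are pairs of vertices. Nonemptiness is part of \<open>Digraph_Component.connected\<close>.
\<close>

text \<open>\<open>Inl v\<close> is the vertex \<open>v\<close> of \<open>G\<close>, and \<open>Inr v\<close> is its copy \<open>v'\<close>.\<close>

definition prism_graph :: "'a pair_pre_digraph \<Rightarrow> ('a \<Rightarrow> 'a) \<Rightarrow> ('a + 'a) pair_pre_digraph" where
  "prism_graph G \<pi> =
     \<lparr> pverts = pverts G <+> pverts G,
       parcs = {(Inl u, Inl v) | u v. (u, v) \<in> parcs G}
             \<union> {(Inr u, Inr v) | u v. (u, v) \<in> parcs G}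
             \<union> {(Inl u, Inr (\<pi> u)) | u. u \<in> pverts G}
             \<union> {(Inr (\<pi> u), Inl u) | u. u \<in> pverts G} \<rparr>"

definition dominating :: "'a pair_pre_digraph \<Rightarrow> 'a set \<Rightarrow> bool" where
  "dominating G A \<longleftrightarrow>
     A \<subseteq> pverts G \<and> (\<forall>v\<in>pverts G. v \<in> A \<or> (\<exists>u\<in>A. (u, v) \<in> parcs G))"

definition path_between :: "'a pair_pre_digraph \<Rightarrow> 'a \<Rightarrow> 'a vwalk \<Rightarrow> 'a \<Rightarrow> bool" where
  "path_between G u p v \<longleftrightarrow> vpath p (with_proj G) \<and> hd p = u \<and> last p = v"

definition shortest_path :: "'a pair_pre_digraph \<Rightarrow> 'a \<Rightarrow> 'a vwalk \<Rightarrow> 'a \<Rightarrow> bool" where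
  "shortest_path G u p v \<longleftrightarrow>
     path_between G u p v \<and> (\<forall>q. path_between G u q v \<longrightarrow> vwalk_length p \<le> vwalk_length q)"

definition weakly_convex :: "'a pair_pre_digraph \<Rightarrow> 'a set \<Rightarrow> bool" where
  "weakly_convex G A \<longleftrightarrow>
     A \<subseteq> pverts G \<and> (\<forall>u\<in>A. \<forall>v\<in>A. \<exists>p. shortest_path G u p v \<and> set p \<subseteq> A)"

text \<open>
  Meaningful for finite connected \<open>G\<close>, where the minimum is over a finite set that contains
  \<open>card (pverts G)\<close>.
\<close>

definition gamma_wcon :: "'a pair_pre_digraph \<Rightarrow> nat" where
  "gamma_wcon G = Min {card A | A. dominating G A \<and> weakly_convex G A}"

end

(*
  For G, take hubs h_i, pairwise joined by otherwise disjoint paths h_i - x_ij - x_ji - h_j of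
  length 3, together with a clique that contains one vertex for each of these vertices. A set that
  contains neither x_ij nor x_ji has to contain h_i and h_j in order to dominate these two
  vertices, and then it is not weakly convex; so weakly convex dominating sets of G have
  quadratically many vertices. If the permutation swaps every h_i and x_ij with its clique vertex,
  then in the prism the hubs are also joined by paths of length 3 through the cliques, and the hubs
  and their clique vertices, in both layers, form a dominating nonexpansive retract of linear size.

  For H, take stars with centres h_i and leaves l_ij, and attach each h_i to its own vertex of a
  clique. The centres and the clique form a weakly convex dominating set of linear size. If the
  permutation swaps l_ij and l_ji, then in the prism h_i - l_ij - l_ji' - h_j' is the only shortest
  path between its ends, and as before every weakly convex dominating set contains l_ij or l_ji'.
*)
theory Submission
  imports Defs
begin

section \<open>Weakly convex dominating sets\<close>

text \<open>Arcs come in both directions, so walks into \<open>r\<close> can be reversed and any two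
  vertices are joined through \<open>r\<close>.\<close>

lemma connectedI_root:
  assumes "pair_graph G" and r: "r \<in> pverts G"
    and reach: "\<And>v. v \<in> pverts G \<Longrightarrow> (v, r) \<in> (parcs G)\<^sup>*"
  shows "Digraph_Component.connected (with_proj G)"
proof -
  interpret pair_graph G by fact
  have sym: "sym (parcs G)"
    using arcs_symmetric by (auto intro: symI)
  have "(parcs G)\<^sup>s = parcs G"
    using sym by (auto simp: symcl_def sym_def)
  moreover have "(u, v) \<in> rtrancl_on (pverts G) (parcs G)"
    if "u \<in> pverts G" "v \<in> pverts G" for u v
  proof (rule rtrancl_consistent_rtrancl_on)
    have "(r, v) \<in> (parcs G)\<^sup>*"
      using reach[OF that(2)] sym by (meson sym_rtrancl symD)
    with reach[OF that(1)] show "(u, v) \<in> (parcs G)\<^sup>*" by (rule rtrancl_trans)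
  qed (use that in_arcsD2 in auto)
  ultimately show ?thesis
    using r by (auto simp: connected_conv)
qed

lemma connected_rtrancl:
  assumes "pair_graph G" "Digraph_Component.connected (with_proj G)"
    and "u \<in> pverts G" "v \<in> pverts G"
  shows "(u, v) \<in> (parcs G)\<^sup>*"
proof -
  interpret pair_graph G by fact
  have "(parcs G)\<^sup>s = parcs G"
    using arcs_symmetric by (auto simp: symcl_def)
  then show ?thesis
    using assms(2-4) by (auto simp: connected_conv intro: rtrancl_on_rtranclI)
qed

text \<open>Cutting the cycles out of a walk keeps its ends, never lengthens it and adds no vertex,
  so distance arguments can work with walks.\<close>

lemma vwalk_path_between:
  assumes "vwalk q (with_proj G)" "hd q = u" "last q = v"
  shows "\<exists>p. path_between G u p v \<and> length p \<le> length q \<and> set p \<subseteq> set q"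
proof (intro exI conjI)
  show "path_between G u (vwalk_to_vpath q) v"
    using assms by (auto simp: path_between_def vwalk_to_vpath_hd vwalk_to_vpath_last
        intro: vwalk_to_vpath_vpath)
  show "set (vwalk_to_vpath q) \<subseteq> set q"
    by (auto intro: vwalk_to_vpath_subset)
  show "length (vwalk_to_vpath q) \<le> length q"
  proof (induct q rule: vwalk_to_vpath_induct3)
    case (in_set x xs)
    then show ?case
      using length_dropWhile_le[of "\<lambda>y. y \<noteq> x" xs] by simp
  qed auto
qed

lemma connected_ex_shortest_path:
  assumes G: "pair_graph G" "Digraph_Component.connected (with_proj G)"
    and "u \<in> pverts G" "v \<in> pverts G"
  shows "\<exists>p. shortest_path G u p v"
proof -
  interpret pair_graph G by fact
  have "\<exists>q. vwalk q (with_proj G) \<and> hd q = u \<and> last q = v"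
    using connected_rtrancl[OF assms]
  proof (induction rule: converse_rtrancl_induct)
    case base
    show ?case
      using assms(4) by (intro exI[of _ "[v]"]) (auto simp: vwalk_def)
  next
    case (step x y)
    then obtain q where "vwalk q (with_proj G)" "hd q = y" "last q = v" by blast
    with step(1) show ?case
      by (intro exI[of _ "x # q"]) (auto intro!: vwalk_consI dest: in_arcsD1)
  qed
  then obtain p where "path_between G u p v"
    using vwalk_path_between by metis
  then show ?thesis
    unfolding shortest_path_def using ex_has_least_nat[of "\<lambda>p. path_between G u p v" p vwalk_length]
    by auto
qed

text \<open>The image of a shortest path under \<open>r\<close> is a walk inside \<open>A\<close>.
  It has the same ends, since \<open>r\<close> fixes them, and it is no longer, since each edge goes
  to an edge or collapses. Removing its cycles leaves a shortest path inside
  \<open>A\<close>.\<close>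

lemma weakly_convex_retract:
  assumes G: "pair_graph G" "Digraph_Component.connected (with_proj G)"
    and "A \<subseteq> pverts G"
    and mem: "\<And>v. v \<in> pverts G \<Longrightarrow> r v \<in> A"
    and fix_A: "\<And>v. v \<in> A \<Longrightarrow> r v = v"
    and arc: "\<And>u v. (u, v) \<in> parcs G \<Longrightarrow> r u = r v \<or> (r u, r v) \<in> parcs G"
  shows "weakly_convex G A"
  unfolding weakly_convex_def
proof (intro conjI ballI)
  show "A \<subseteq> pverts G" by fact
  interpret pair_graph G by fact
  have image: "\<exists>q. vwalk q (with_proj G) \<and> hd q = r (hd p) \<and> last q = r (last p)
      \<and> length q \<le> length p \<and> set q \<subseteq> A" if "vwalk p (with_proj G)" for p
    using that
  proof (induction rule: vwalk_induct)
    case (Base u)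
    then show ?case
      using mem \<open>A \<subseteq> pverts G\<close> by (intro exI[of _ "[r u]"]) (auto simp: vwalk_def)
  next
    case (Cons u v es)
    then obtain q where q: "vwalk q (with_proj G)" "hd q = r v" "last q = r (last (v # es))"
      "length q \<le> length (v # es)" "set q \<subseteq> A" by auto
    have u: "u \<in> pverts G" using Cons(1) by (auto dest: in_arcsD1)
    consider "r u = r v" | "(r u, r v) \<in> parcs G" using arc Cons(1) by auto
    then show ?case
    proof cases
      case 1
      with q show ?thesis by (intro exI[of _ q]) auto
    next
      case 2
      then have "vwalk (r u # q) (with_proj G)"
        using q by (auto intro!: vwalk_consI dest: in_arcsD1)
      with q show ?thesis
        using mem[OF u] by (intro exI[of _ "r u # q"]) auto
    qed
  qed
  fix u v assume uv: "u \<in> A" "v \<in> A"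
  then obtain p where p: "shortest_path G u p v"
    using connected_ex_shortest_path[OF G] \<open>A \<subseteq> pverts G\<close> by blast
  then have "vwalk p (with_proj G)" "hd p = u" "last p = v"
    by (auto simp: shortest_path_def path_between_def vpath_def)
  from image[OF this(1)] this(2,3) uv obtain q
    where "vwalk q (with_proj G)" "hd q = u" "last q = v" "length q \<le> length p" "set q \<subseteq> A"
    by (auto simp: fix_A)
  moreover from vwalk_path_between[OF this(1-3)] obtain q'
    where "path_between G u q' v" "length q' \<le> length q" "set q' \<subseteq> set q" by blast
  ultimately have "path_between G u q' v" "length q' \<le> length p" "set q' \<subseteq> A" by auto
  then have "shortest_path G u q' v"
    using p by (fastforce simp: shortest_path_def)
  then show "\<exists>p. shortest_path G u p v \<and> set p \<subseteq> A"
    using \<open>set q' \<subseteq> A\<close> by blast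
qed

text \<open>The walk bounds the distance by three and \<open>far\<close> excludes smaller distances,
  so every shortest path has exactly two inner vertices. Weak convexity puts those of some shortest
  path into \<open>A\<close>.\<close>

lemma weakly_convex_distance3:
  assumes "pair_graph G" "weakly_convex G A" "u \<in> A" "v \<in> A"
    and walk: "(u, a) \<in> parcs G" "(a, b) \<in> parcs G" "(b, v) \<in> parcs G"
    and far: "u \<noteq> v" "(u, v) \<notin> parcs G" "\<And>x. (u, x) \<in> parcs G \<Longrightarrow> (x, v) \<notin> parcs G"
  shows "\<exists>x\<in>A. \<exists>y\<in>A. (u, x) \<in> parcs G \<and> (x, y) \<in> parcs G \<and> (y, v) \<in> parcs G"
proof -
  interpret pair_graph G by fact
  obtain p where p: "shortest_path G u p v" "set p \<subseteq> A"
    using assms(2-4) unfolding weakly_convex_def by blast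
  have "vwalk [u, a, b, v] (with_proj G)"
    using walk by (auto simp: vwalk_def dest: in_arcsD1 in_arcsD2)
  \<comment> \<open>\<open>length\<close> counts vertices, so three edges give the bound 4.\<close>
  from vwalk_path_between[OF this refl refl]
  obtain q where "path_between G u q v" "length q \<le> 4" by auto
  with p(1) have len: "length p \<le> 4"
    by (fastforce simp: shortest_path_def)
  have pw: "p \<noteq> []" "set (vwalk_arcs p) \<subseteq> parcs G" "hd p = u" "last p = v"
    using p(1) by (auto simp: shortest_path_def path_between_def vpath_def vwalk_def)
  \<comment> \<open>The path is uncovered vertex by vertex: each clause of \<open>far\<close> rules
    out stopping at the vertex just reached, and the length bound stops it at the fourth.\<close>
  obtain p1 where p1: "p = u # p1" using pw by (cases p) auto
  obtain x p2 where p2: "p1 = x # p2" using pw far(1) p1 by (cases p1) auto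
  obtain y p3 where p3: "p2 = y # p3" using pw far(2) p1 p2 by (cases p2) auto
  obtain z p4 where p4: "p3 = z # p4"
    using pw far(3)[of x] p1 p2 p3 by (cases p3) auto
  have "p4 = []" using len p1 p2 p3 p4 by simp
  with p(2) pw p1 p2 p3 p4 show ?thesis by auto
qed

section \<open>Upper and lower bounds for \<open>gamma_wcon\<close>\<close>

lemma gamma_wcon_le:
  assumes "pair_graph G" "dominating G A" "weakly_convex G A"
  shows "gamma_wcon G \<le> card A"
proof -
  interpret pair_graph G by fact
  have "{card A | A. dominating G A \<and> weakly_convex G A} \<subseteq> card ` Pow (pverts G)"
    by (auto simp: dominating_def)
  then have "finite {card A | A. dominating G A \<and> weakly_convex G A}"
    by (rule finite_subset) (simp add: pair_finite_verts)
  then show ?thesis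
    unfolding gamma_wcon_def using assms by (auto intro: Min_le)
qed

text \<open>\<open>Min\<close> says something only about a nonempty set. Connectivity supplies a
  member: the whole vertex set is weakly convex by the identity retraction.\<close>

lemma le_gamma_wcon:
  assumes G: "pair_graph G" "Digraph_Component.connected (with_proj G)"
    and bound: "\<And>A. dominating G A \<Longrightarrow> weakly_convex G A \<Longrightarrow> b \<le> card A"
  shows "b \<le> gamma_wcon G"
proof -
  interpret pair_graph G by fact
  let ?C = "{card A | A. dominating G A \<and> weakly_convex G A}"
  have "?C \<subseteq> card ` Pow (pverts G)"
    by (auto simp: dominating_def)
  then have "finite ?C"
    by (rule finite_subset) (simp add: pair_finite_verts)
  moreover have "dominating G (pverts G)"
    by (simp add: dominating_def)
  moreover have "weakly_convex G (pverts G)"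
    by (rule weakly_convex_retract[OF G, where r = id]) auto
  ultimately show ?thesis
    unfolding gamma_wcon_def using bound by (subst Min_ge_iff) blast+
qed

text \<open>Picking a point of \<open>A\<close> from each \<open>S p\<close> is injective by
  disjointness. Both lower bounds apply this to the inner vertices of quadratically many shortest
  paths.\<close>

lemma card_le_if_meets_disjoint:
  assumes "finite A"
    and meets: "\<And>p. p \<in> P \<Longrightarrow> S p \<inter> A \<noteq> {}"
    and disj: "\<And>p q. p \<in> P \<Longrightarrow> q \<in> P \<Longrightarrow> S p \<inter> S q \<noteq> {} \<Longrightarrow> p = q"
  shows "card P \<le> card A"
proof -
  obtain f where f: "\<And>p. p \<in> P \<Longrightarrow> f p \<in> S p \<inter> A"
    using bchoice[of P "\<lambda>p x. x \<in> S p \<inter> A"] meets by blast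
  have "inj_on f P"
  proof (rule inj_onI)
    fix p q assume "p \<in> P" "q \<in> P" "f p = f q"
    then have "f p \<in> S p \<inter> S q" using f by (metis Int_iff)
    with \<open>p \<in> P\<close> \<open>q \<in> P\<close> show "p = q" using disj by blast
  qed
  then show ?thesis
    using f \<open>finite A\<close> by (intro card_inj_on_le[of f]) auto
qed

section \<open>Prisms\<close>

lemma pverts_prism_graph [simp]: "pverts (prism_graph G \<pi>) = pverts G <+> pverts G"
  by (simp add: prism_graph_def)

lemma parcs_prism_graph [simp]:
  "(Inl u, Inl v) \<in> parcs (prism_graph G \<pi>) \<longleftrightarrow> (u, v) \<in> parcs G"
  "(Inr u, Inr v) \<in> parcs (prism_graph G \<pi>) \<longleftrightarrow> (u, v) \<in> parcs G"
  "(Inl u, Inr v) \<in> parcs (prism_graph G \<pi>) \<longleftrightarrow> u \<in> pverts G \<and> v = \<pi> u"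
  "(Inr v, Inl u) \<in> parcs (prism_graph G \<pi>) \<longleftrightarrow> u \<in> pverts G \<and> v = \<pi> u"
  by (auto simp: prism_graph_def)

lemma pair_graph_prism_graph:
  assumes "pair_graph G" "\<pi> permutes pverts G"
  shows "pair_graph (prism_graph G \<pi>)"
proof -
  interpret pair_graph G by fact
  have \<pi>: "\<pi> u \<in> pverts G" if "u \<in> pverts G" for u
    using permutes_in_image[OF assms(2)] that by simp
  have arcs: "parcs (prism_graph G \<pi>)
      \<subseteq> (pverts G <+> pverts G) \<times> (pverts G <+> pverts G)"
    by (auto simp: prism_graph_def \<pi> dest: in_arcsD1 in_arcsD2)
  have "finite (parcs (prism_graph G \<pi>))"
    by (rule finite_subset[OF arcs]) (simp add: pair_finite_verts)
  then show ?thesis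
    using arcs
    by unfold_locales
      (auto simp: pair_finite_verts symmetric_def sym_def prism_graph_def
        dest: no_loops' arcs_symmetric in_arcsD1 in_arcsD2 intro: \<pi>)
qed

text \<open>The left layer is connected as a copy of \<open>G\<close>, and surjectivity of
  \<open>\<pi>\<close> gives every right vertex a partner there.\<close>

lemma connected_prism_graph:
  assumes G: "pair_graph G" "Digraph_Component.connected (with_proj G)"
    and \<pi>: "\<pi> permutes pverts G"
  shows "Digraph_Component.connected (with_proj (prism_graph G \<pi>))"
proof -
  obtain r where r: "r \<in> pverts G"
    using G(2) by (auto simp: connected_conv)
  have Inl: "(Inl v, Inl r) \<in> (parcs (prism_graph G \<pi>))\<^sup>*" if "v \<in> pverts G" for v
    using connected_rtrancl[OF G that r]
  proof (induction rule: converse_rtrancl_induct)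
    case (step y z)
    then have "(Inl y, Inl z) \<in> parcs (prism_graph G \<pi>)" by simp
    then show ?case using step.IH by (rule converse_rtrancl_into_rtrancl)
  qed simp
  have Inr: "(Inr v, Inl r) \<in> (parcs (prism_graph G \<pi>))\<^sup>*" if v: "v \<in> pverts G" for v
  proof -
    obtain u where u: "u \<in> pverts G" "v = \<pi> u"
      using permutes_image[OF \<pi>] v by blast
    then have "(Inr v, Inl u) \<in> parcs (prism_graph G \<pi>)" by simp
    then show ?thesis using Inl[OF u(1)] by (rule converse_rtrancl_into_rtrancl)
  qed
  show ?thesis
    by (rule connectedI_root[OF pair_graph_prism_graph[OF G(1) \<pi>], of "Inl r"])
      (use r Inl Inr in auto)
qed

section \<open>Graphs on coded vertices\<close>

text \<open>Tuples describe the vertices conveniently while the theorem asks for graphs on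
  \<open>nat\<close>, hence the coding. Symmetry and absence of loops are built in, so
  \<open>R\<close> may list one orientation of an edge only and may relate a vertex to
  itself.\<close>

definition coded_graph :: "'a::countable set \<Rightarrow> ('a \<Rightarrow> 'a \<Rightarrow> bool) \<Rightarrow> nat pair_pre_digraph" where
  "coded_graph V R =
     \<lparr> pverts = to_nat ` V,
       parcs = {(to_nat u, to_nat v) | u v. u \<in> V \<and> v \<in> V \<and> u \<noteq> v \<and> (R u v \<or> R v u)} \<rparr>"

lemma pverts_coded_graph [simp]: "pverts (coded_graph V R) = to_nat ` V"
  by (simp add: coded_graph_def)

lemma parcs_coded_graph:
  "parcs (coded_graph V R) =
     {(to_nat u, to_nat v) | u v. u \<in> V \<and> v \<in> V \<and> u \<noteq> v \<and> (R u v \<or> R v u)}"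
  by (simp add: coded_graph_def)

lemma to_nat_in_parcs_coded_graph [simp]:
  "(to_nat u, to_nat v) \<in> parcs (coded_graph V R)
     \<longleftrightarrow> u \<in> V \<and> v \<in> V \<and> u \<noteq> v \<and> (R u v \<or> R v u)"
  by (auto simp: coded_graph_def)

lemma to_nat_in_image [simp]: "to_nat v \<in> to_nat ` V \<longleftrightarrow> v \<in> V"
  by auto

lemma pair_graph_coded_graph:
  assumes "finite V"
  shows "pair_graph (coded_graph V R)"
proof -
  have arcs: "parcs (coded_graph V R) \<subseteq> to_nat ` V \<times> to_nat ` V"
    by (auto simp: coded_graph_def)
  have "finite (parcs (coded_graph V R))"
    by (rule finite_subset[OF arcs]) (simp add: assms)
  then show ?thesis
    using assms by unfold_locales (auto simp: coded_graph_def symmetric_def sym_def)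
qed

definition coded_perm :: "'a::countable set \<Rightarrow> ('a \<Rightarrow> 'a) \<Rightarrow> nat \<Rightarrow> nat" where
  "coded_perm V s n = (if n \<in> to_nat ` V then to_nat (s (from_nat n)) else n)"

lemma coded_perm_to_nat [simp]: "v \<in> V \<Longrightarrow> coded_perm V s (to_nat v) = to_nat (s v)"
  by (simp add: coded_perm_def)

text \<open>As \<open>s\<close> is an involution on \<open>V\<close>, the coded map is its own
  inverse there.\<close>

lemma coded_perm_permutes:
  assumes "\<And>v. v \<in> V \<Longrightarrow> s v \<in> V" "\<And>v. v \<in> V \<Longrightarrow> s (s v) = v"
  shows "coded_perm V s permutes to_nat ` V"
proof (rule bij_imp_permutes)
  show "bij_betw (coded_perm V s) (to_nat ` V) (to_nat ` V)"
    by (rule bij_betw_byWitness[where f' = "coded_perm V s"]) (auto simp: assms)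
qed (simp add: coded_perm_def)

text \<open>For a symmetric property the orientation listed by \<open>R\<close> is enough. The rule
  serves to check that a map is a retraction.\<close>

lemma coded_graph_arc_cases [consumes 1, case_names sym arc]:
  assumes "(x, y) \<in> parcs (coded_graph V R)"
    and sym: "\<And>x y. P x y \<Longrightarrow> P y x"
    and arc: "\<And>u v. u \<in> V \<Longrightarrow> v \<in> V \<Longrightarrow> u \<noteq> v \<Longrightarrow> R u v \<Longrightarrow> P (to_nat u) (to_nat v)"
  shows "P x y"
proof -
  obtain u v where *: "x = to_nat u" "y = to_nat v" "u \<in> V" "v \<in> V" "u \<noteq> v" "R u v \<or> R v u"
    using assms(1) by (auto simp: coded_graph_def)
  show ?thesis
    using *(6)
  proof
    assume "R u v"
    then show ?thesis using arc * by blast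
  next
    assume "R v u"
    then have "P y x" using arc * by blast
    then show ?thesis by (rule sym)
  qed
qed

lemma coded_prism_arc_cases [consumes 1, case_names sym left right cross]:
  assumes "(x, y) \<in> parcs (prism_graph (coded_graph V R) (coded_perm V s))"
    and sym: "\<And>x y. P x y \<Longrightarrow> P y x"
    and left: "\<And>u v. u \<in> V \<Longrightarrow> v \<in> V \<Longrightarrow> u \<noteq> v \<Longrightarrow> R u v \<Longrightarrow> P (Inl (to_nat u)) (Inl (to_nat v))"
    and right: "\<And>u v. u \<in> V \<Longrightarrow> v \<in> V \<Longrightarrow> u \<noteq> v \<Longrightarrow> R u v \<Longrightarrow> P (Inr (to_nat u)) (Inr (to_nat v))"
    and cross: "\<And>u. u \<in> V \<Longrightarrow> P (Inl (to_nat u)) (Inr (to_nat (s u)))"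
  shows "P x y"
proof -
  have Inl: "P (Inl a) (Inl b)" if "(a, b) \<in> parcs (coded_graph V R)" for a b
    using that by (induction rule: coded_graph_arc_cases) (auto intro: sym left)
  have Inr: "P (Inr a) (Inr b)" if "(a, b) \<in> parcs (coded_graph V R)" for a b
    using that by (induction rule: coded_graph_arc_cases) (auto intro: sym right)
  have cross': "P (Inl a) (Inr (coded_perm V s a))" if "a \<in> to_nat ` V" for a
    using that cross by auto
  show ?thesis
    using assms(1) by (cases x; cases y) (auto intro: Inl Inr cross' sym)
qed

section \<open>Long shortest paths that the prism avoids\<close>

text \<open>The disjunct \<open>i = j \<and> k = i\<close> joins a hub to its inner vertices, and
  \<open>k = j \<and> l = i\<close> is the middle edge of the path between two hubs.\<close>

fun hub_clique_adj :: "bool \<times> nat \<times> nat \<Rightarrow> bool \<times> nat \<times> nat \<Rightarrow> bool" where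
  "hub_clique_adj (False, i, j) (False, k, l) \<longleftrightarrow> i = j \<and> k = i \<or> k = j \<and> l = i"
| "hub_clique_adj (True, _) (True, _) \<longleftrightarrow> True"
| "hub_clique_adj (True, _) (False, k, l) \<longleftrightarrow> k = 0 \<and> l = 0"
| "hub_clique_adj (False, _) (True, _) \<longleftrightarrow> False"

definition square :: "nat \<Rightarrow> (bool \<times> nat \<times> nat) set" where
  "square n = UNIV \<times> {..<n} \<times> {..<n}"

lemma mem_square [simp]: "(b, i, j) \<in> square n \<longleftrightarrow> i < n \<and> j < n"
  by (simp add: square_def)

text \<open>\<open>(False, i, i)\<close> is the hub \<open>h\<^sub>i\<close>, \<open>(False, i, j)\<close> with \<open>i \<noteq> j\<close> is the inner vertex \<open>x\<^sub>i\<^sub>j\<close>, and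
  \<open>(True, i, j)\<close> is the clique vertex of \<open>(False, i, j)\<close>. Only \<open>h\<^sub>0\<close> is adjacent to the clique.\<close>

definition hub_clique :: "nat \<Rightarrow> nat pair_pre_digraph" where
  "hub_clique n = coded_graph (square n) hub_clique_adj"

lemma pair_graph_hub_clique: "pair_graph (hub_clique n)"
  unfolding hub_clique_def by (rule pair_graph_coded_graph) (simp add: square_def)

lemma connected_hub_clique:
  assumes "0 < n"
  shows "Digraph_Component.connected (with_proj (hub_clique n))"
proof (rule connectedI_root[OF pair_graph_hub_clique])
  let ?r = "to_nat (True, 0 :: nat, 0 :: nat)"
  let ?E = "parcs (hub_clique n)"
  show "?r \<in> pverts (hub_clique n)"
    using assms by (auto simp: hub_clique_def)
  \<comment> \<open>Passing to the closure absorbs the case \<open>u = v\<close>, which occurs below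
    when indices coincide.\<close>
  have arc: "(to_nat u, to_nat v) \<in> ?E\<^sup>*"
    if "u \<in> square n" "v \<in> square n" "hub_clique_adj u v \<or> hub_clique_adj v u" for u v
    using that by (cases "u = v") (auto simp: hub_clique_def)
  have clique: "(to_nat (True, i, j), ?r) \<in> ?E\<^sup>*" if "i < n" "j < n" for i j
    using that assms by (intro arc) auto
  have hub0: "(to_nat (False, 0 :: nat, 0 :: nat), ?r) \<in> ?E\<^sup>*"
    using assms by (intro arc) auto
  have other: "(to_nat (False, i, j), to_nat (False, 0 :: nat, 0 :: nat)) \<in> ?E\<^sup>*"
    if "i < n" "j < n" for i j
  proof -
    \<comment> \<open>The route from x_ij to h_0 runs through h_i, x_i0 and x_0i.\<close>
    have "(to_nat (False, i, j), to_nat (False, i, i)) \<in> ?E\<^sup>*"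
      "(to_nat (False, i, i), to_nat (False, i, 0 :: nat)) \<in> ?E\<^sup>*"
      "(to_nat (False, i, 0 :: nat), to_nat (False, 0 :: nat, i)) \<in> ?E\<^sup>*"
      "(to_nat (False, 0 :: nat, i), to_nat (False, 0 :: nat, 0 :: nat)) \<in> ?E\<^sup>*"
      using that assms by (auto intro!: arc)
    then show ?thesis by (meson rtrancl_trans)
  qed
  fix v assume "v \<in> pverts (hub_clique n)"
  then obtain b :: bool and i j :: nat where "v = to_nat (b, i, j)" "i < n" "j < n"
    by (auto simp: hub_clique_def square_def)
  then show "(v, ?r) \<in> ?E\<^sup>*"
    using clique rtrancl_trans[OF other hub0] by (cases b) auto
qed

section \<open>Quadratic lower bound for the hub graph\<close>

lemma hub_clique_nbr_outer:
  assumes "(u, to_nat (False, i :: nat, j :: nat)) \<in> parcs (hub_clique n)" "i \<noteq> j"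
  shows "u = to_nat (False, i, i) \<or> u = to_nat (False, j, i)"
proof -
  obtain b :: bool and k l :: nat where u: "u = to_nat (b, k, l)"
    using assms(1) by (auto simp: hub_clique_def parcs_coded_graph)
  show ?thesis
    using assms unfolding u by (cases b) (auto simp: hub_clique_def)
qed

lemma hub_clique_nbr_hub:
  assumes "(to_nat (False, i :: nat, i), u) \<in> parcs (hub_clique n)"
  shows "(\<exists>j. j \<noteq> i \<and> u = to_nat (False, i, j)) \<or> i = 0 \<and> (\<exists>k l. u = to_nat (True, k :: nat, l :: nat))"
proof -
  obtain b :: bool and k l :: nat where u: "u = to_nat (b, k, l)"
    using assms(1) by (auto simp: hub_clique_def parcs_coded_graph)
  show ?thesis
    using assms unfolding u by (cases b) (auto simp: hub_clique_def)
qed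

lemma hub_clique_lower:
  assumes A: "dominating (hub_clique (2 * m)) A" "weakly_convex (hub_clique (2 * m)) A"
  shows "m * m \<le> card A"
proof -
  let ?G = "hub_clique (2 * m)"
  interpret G: pair_graph ?G by (rule pair_graph_hub_clique)
  let ?x = "\<lambda>(i :: nat) (j :: nat). to_nat (False, i, j) :: nat"
  \<comment> \<open>\<open>S (i, j) = S (j, i)\<close>, so the pairs below have their components in different halves.\<close>
  define S where "S = (\<lambda>(i, j). {?x i j, ?x j i})"
  have "finite A"
    using A(1) G.pair_finite_verts finite_subset by (metis dominating_def)
  moreover have "S p \<inter> A \<noteq> {}" if "p \<in> {..<m} \<times> {m..<2 * m}" for p
  proof
    obtain i j where p: "p = (i, j)" by (cases p)
    have ij: "i < 2 * m" "j < 2 * m" "i \<noteq> j" using that p by auto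
    assume none: "S p \<inter> A = {}"
    \<comment> \<open>With x_ij and x_ji both outside \<open>A\<close>, each of them can only be
      dominated by its own hub.\<close>
    have dom: "?x k k \<in> A" if "(k, l) = (i, j) \<or> (k, l) = (j, i)" for k l
    proof -
      have "?x k l \<in> pverts ?G" "?x k l \<notin> A" "?x l k \<notin> A"
        using that ij none by (auto simp: hub_clique_def S_def p)
      then obtain u where "u \<in> A" "(u, ?x k l) \<in> parcs ?G"
        using A(1) by (auto simp: dominating_def)
      moreover have "k \<noteq> l" using that ij by auto
      ultimately show ?thesis
        using hub_clique_nbr_outer \<open>?x l k \<notin> A\<close> by blast
    qed
    have nbr_j: "(\<exists>l. l \<noteq> j \<and> x = ?x j l) \<or> j = 0 \<and> (\<exists>k l. x = to_nat (True, k :: nat, l :: nat))"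
      if "(x, ?x j j) \<in> parcs ?G" for x
      using hub_clique_nbr_hub G.arcs_symmetric[OF that] by blast
    have "\<exists>x\<in>A. \<exists>y\<in>A. (?x i i, x) \<in> parcs ?G \<and> (x, y) \<in> parcs ?G \<and> (y, ?x j j) \<in> parcs ?G"
    proof (rule weakly_convex_distance3[OF pair_graph_hub_clique A(2)])
      show "(?x i i, ?x i j) \<in> parcs ?G" "(?x i j, ?x j i) \<in> parcs ?G"
        "(?x j i, ?x j j) \<in> parcs ?G" "?x i i \<noteq> ?x j j" "(?x i i, ?x j j) \<notin> parcs ?G"
        using ij by (auto simp: hub_clique_def)
      \<comment> \<open>Different hubs have different inner vertices, and only h_0 has neighbours in
        the clique.\<close>
      show "(x, ?x j j) \<notin> parcs ?G" if "(?x i i, x) \<in> parcs ?G" for x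
        using hub_clique_nbr_hub[OF that] nbr_j[of x] ij by auto
    qed (use dom in auto)
    then obtain x y where xy: "x \<in> A" "y \<in> A" "(?x i i, x) \<in> parcs ?G" "(x, y) \<in> parcs ?G"
      "(y, ?x j j) \<in> parcs ?G" by blast
    \<comment> \<open>The two middle vertices must be x_ij and x_ji: no other inner vertices of h_i
      and h_j are adjacent, and no clique vertex is adjacent to an inner vertex.\<close>
    show False
      using hub_clique_nbr_hub[OF xy(3)] nbr_j[OF xy(5)] xy(1,2,4) none ij
      by (auto simp: S_def p hub_clique_def)
  qed
  moreover have "p = q"
    if "p \<in> {..<m} \<times> {m..<2 * m}" "q \<in> {..<m} \<times> {m..<2 * m}" "S p \<inter> S q \<noteq> {}" for p q
    using that by (auto simp: S_def)
  ultimately have "card ({..<m} \<times> {m..<2 * m}) \<le> card A"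
    by (rule card_le_if_meets_disjoint)
  then show ?thesis by simp
qed

section \<open>Linear upper bound for the prism over the hub graph\<close>

definition hub_clique_perm :: "nat \<Rightarrow> nat \<Rightarrow> nat" where
  "hub_clique_perm n = coded_perm (square n) (\<lambda>(b, i, j). (\<not> b, i, j))"

lemma hub_clique_perm_permutes: "hub_clique_perm n permutes pverts (hub_clique n)"
  unfolding hub_clique_perm_def hub_clique_def pverts_coded_graph
  by (rule coded_perm_permutes) (auto simp: square_def)

text \<open>Serves both constructions: the hubs and their clique vertices in the first graph, the
  centres and the whole clique in the second.\<close>

definition diagonal :: "nat \<Rightarrow> (bool \<times> nat \<times> nat) set" where
  "diagonal n = (\<lambda>(b, i). (b, i, i)) ` (UNIV \<times> {..<n})"

lemma mem_diagonal [simp]: "(b, i, j) \<in> diagonal n \<longleftrightarrow> i = j \<and> i < n"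
  by (auto simp: diagonal_def)

lemma finite_diagonal: "finite (diagonal n)"
  by (simp add: diagonal_def)

lemma card_diagonal_le: "card (to_nat ` diagonal n) \<le> 2 * n"
proof -
  have "card (to_nat ` diagonal n) \<le> card (diagonal n)"
    by (rule card_image_le) (rule finite_diagonal)
  also have "\<dots> \<le> card ((UNIV :: bool set) \<times> {..<n})"
    unfolding diagonal_def by (rule card_image_le) simp
  finally show ?thesis by (simp add: card_cartesian_product)
qed

lemma gamma_wcon_prism_hub_clique:
  assumes "0 < n"
  shows "gamma_wcon (prism_graph (hub_clique n) (hub_clique_perm n)) \<le> 4 * n"
proof -
  let ?G = "prism_graph (hub_clique n) (hub_clique_perm n)"
  let ?A = "to_nat ` diagonal n <+> to_nat ` diagonal n"
  note G = pair_graph_prism_graph[OF pair_graph_hub_clique hub_clique_perm_permutes]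
    and con = connected_prism_graph[OF pair_graph_hub_clique connected_hub_clique[OF assms]
      hub_clique_perm_permutes]
  \<comment> \<open>The inner vertex \<open>x\<^sub>i\<^sub>j\<close> has to move to the other layer, where its clique vertex is matched.\<close>
  define r :: "nat + nat \<Rightarrow> nat + nat" where
    "r = case_sum
      (\<lambda>x. case from_nat x of (b :: bool, i :: nat, j) \<Rightarrow>
        if b \<or> i = j then Inl (to_nat (b, i, i)) else Inr (to_nat (True, i, i)))
      (\<lambda>x. case from_nat x of (b :: bool, i :: nat, j) \<Rightarrow>
        if b \<or> i = j then Inr (to_nat (b, i, i)) else Inl (to_nat (True, i, i)))"
  have "weakly_convex ?G ?A"
  proof (rule weakly_convex_retract[OF G con, where r = r])
    show "?A \<subseteq> pverts ?G"
      by (auto simp: hub_clique_def diagonal_def square_def)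
    show "r v \<in> ?A" if "v \<in> pverts ?G" for v
      using that by (auto simp: r_def hub_clique_def square_def)
    show "r v = v" if "v \<in> ?A" for v
      using that by (auto simp: r_def diagonal_def)
    \<comment> \<open>The edge from h_i to x_ij goes to the matching edge between h_i and its clique
      vertex in the other layer, the edge from x_ij to x_ji goes to a clique edge, and the matching
      edge at x_ij collapses.\<close>
    show "r u = r v \<or> (r u, r v) \<in> parcs ?G" if "(u, v) \<in> parcs ?G" for u v
      using that unfolding hub_clique_def hub_clique_perm_def
    proof (induction rule: coded_prism_arc_cases)
      case (sym x y)
      then show ?case
        using pair_sym_digraph.arcs_symmetric[of ?G] G
        unfolding hub_clique_def hub_clique_perm_def
        by (auto simp: pair_graph_def pair_pseudo_graph_def)
    next
      case (left u v)
      obtain b i j c k l where uv: "u = (b, i, j)" "v = (c, k, l)"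
        by (cases u, cases v)
      with left show ?case by (cases b; cases c) (auto simp: r_def)
    next
      case (right u v)
      obtain b i j c k l where uv: "u = (b, i, j)" "v = (c, k, l)"
        by (cases u, cases v)
      with right show ?case by (cases b; cases c) (auto simp: r_def)
    next
      case (cross u)
      obtain b i j where u: "u = (b, i, j)"
        by (cases u)
      with cross show ?case by (cases b) (auto simp: r_def)
    qed
  qed
  moreover have "dominating ?G ?A"
    unfolding dominating_def
  proof (intro conjI ballI)
    show "?A \<subseteq> pverts ?G"
      by (auto simp: hub_clique_def diagonal_def square_def)
    fix v assume "v \<in> pverts ?G"
    then obtain b :: bool and i j :: nat where *: "i < n" "j < n"
      "v = Inl (to_nat (b, i, j)) \<or> v = Inr (to_nat (b, i, j))"
      by (auto simp: hub_clique_def square_def)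
    have diag: "to_nat (b, i, i) \<in> to_nat ` diagonal n"
      using * by simp
    \<comment> \<open>Within its own layer, h_i dominates x_ij and the clique vertex of h_i
      dominates that of x_ij.\<close>
    have "i = j \<or> (to_nat (b, i, i), to_nat (b, i, j)) \<in> parcs (hub_clique n)"
      using * by (cases b) (auto simp: hub_clique_def)
    with * diag show "v \<in> ?A \<or> (\<exists>u\<in>?A. (u, v) \<in> parcs ?G)"
      by (elim disjE) (auto intro: bexI[of _ "Inl (to_nat (b, i, i))"] bexI[of _ "Inr (to_nat (b, i, i))"])
  qed
  ultimately have "gamma_wcon ?G \<le> card ?A"
    by (intro gamma_wcon_le G)
  also have "\<dots> = 2 * card (to_nat ` diagonal n)"
    by (simp add: card_Plus finite_diagonal)
  finally show ?thesis
    using card_diagonal_le[of n] by simp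
qed

section \<open>Short cuts that the prism creates\<close>

fun clique_stars_adj :: "bool \<times> nat \<times> nat \<Rightarrow> bool \<times> nat \<times> nat \<Rightarrow> bool" where
  "clique_stars_adj (False, i, j) (False, k, l) \<longleftrightarrow> i = j \<and> k = i"
| "clique_stars_adj (True, _) (True, _) \<longleftrightarrow> True"
| "clique_stars_adj (True, i, _) (False, k, l) \<longleftrightarrow> k = i \<and> l = i"
| "clique_stars_adj (False, _) (True, _) \<longleftrightarrow> False"

text \<open>\<open>(False, i, i)\<close> is the centre \<open>h\<^sub>i\<close>, \<open>(False, i, j)\<close> with \<open>i \<noteq> j\<close> is the leaf \<open>l\<^sub>i\<^sub>j\<close>, and
  \<open>(True, i, i)\<close> is the clique vertex attached to \<open>h\<^sub>i\<close>.\<close>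

definition clique_stars_verts :: "nat \<Rightarrow> (bool \<times> nat \<times> nat) set" where
  "clique_stars_verts n = {(b, i, j). i < n \<and> j < n \<and> (b \<longrightarrow> i = j)}"

lemma mem_clique_stars_verts [simp]:
  "(b, i, j) \<in> clique_stars_verts n \<longleftrightarrow> i < n \<and> j < n \<and> (b \<longrightarrow> i = j)"
  by (simp add: clique_stars_verts_def)

definition clique_stars :: "nat \<Rightarrow> nat pair_pre_digraph" where
  "clique_stars n = coded_graph (clique_stars_verts n) clique_stars_adj"

lemma pair_graph_clique_stars: "pair_graph (clique_stars n)"
  unfolding clique_stars_def
proof (rule pair_graph_coded_graph)
  have "clique_stars_verts n \<subseteq> square n" by auto
  then show "finite (clique_stars_verts n)"
    by (rule finite_subset) (simp add: square_def)
qed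

lemma connected_clique_stars:
  assumes "0 < n"
  shows "Digraph_Component.connected (with_proj (clique_stars n))"
proof (rule connectedI_root[OF pair_graph_clique_stars])
  let ?r = "to_nat (True, 0 :: nat, 0 :: nat)"
  let ?E = "parcs (clique_stars n)"
  show "?r \<in> pverts (clique_stars n)"
    using assms by (auto simp: clique_stars_def)
  have arc: "(to_nat u, to_nat v) \<in> ?E\<^sup>*"
    if "u \<in> clique_stars_verts n" "v \<in> clique_stars_verts n"
      "clique_stars_adj u v \<or> clique_stars_adj v u" for u v
    using that by (cases "u = v") (auto simp: clique_stars_def)
  have clique: "(to_nat (True, i, i), ?r) \<in> ?E\<^sup>*" if "i < n" for i
    using that assms by (intro arc) auto
  have other: "(to_nat (False, i, j), to_nat (True, i, i)) \<in> ?E\<^sup>*" if "i < n" "j < n" for i j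
  proof -
    have "(to_nat (False, i, j), to_nat (False, i, i)) \<in> ?E\<^sup>*"
      "(to_nat (False, i, i), to_nat (True, i, i)) \<in> ?E\<^sup>*"
      using that by (auto intro!: arc)
    then show ?thesis by (rule rtrancl_trans)
  qed
  fix v assume "v \<in> pverts (clique_stars n)"
  then obtain b :: bool and i j :: nat where "v = to_nat (b, i, j)" "i < n" "j < n" "b \<longrightarrow> i = j"
    by (auto simp: clique_stars_def clique_stars_verts_def)
  then show "(v, ?r) \<in> ?E\<^sup>*"
    using clique rtrancl_trans[OF other clique] by (cases b) auto
qed

section \<open>Linear upper bound for the clique with stars\<close>

lemma gamma_wcon_clique_stars:
  assumes "0 < n"
  shows "gamma_wcon (clique_stars n) \<le> 2 * n"
proof -
  let ?H = "clique_stars n"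
  let ?A = "to_nat ` diagonal n"
  interpret H: pair_graph ?H by (rule pair_graph_clique_stars)
  \<comment> \<open>Each leaf is folded onto its centre, so star edges collapse and all other edges
    stay fixed.\<close>
  define r where "r = (\<lambda>x. case from_nat x of (b :: bool, i :: nat, j :: nat) \<Rightarrow> to_nat (b, i, i))"
  have sub: "?A \<subseteq> pverts ?H"
    by (auto simp: clique_stars_def clique_stars_verts_def diagonal_def)
  have "weakly_convex ?H ?A"
  proof (rule weakly_convex_retract[OF pair_graph_clique_stars connected_clique_stars[OF assms] sub])
    show "r v \<in> ?A" if "v \<in> pverts ?H" for v
      using that by (auto simp: r_def clique_stars_def clique_stars_verts_def)
    show "r v = v" if "v \<in> ?A" for v
      using that by (auto simp: r_def diagonal_def)
    show "r u = r v \<or> (r u, r v) \<in> parcs ?H" if "(u, v) \<in> parcs ?H" for u v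
      using that unfolding clique_stars_def
    proof (induction rule: coded_graph_arc_cases)
      case (sym x y)
      then show ?case
        using H.arcs_symmetric unfolding clique_stars_def by auto
    next
      case (arc u v)
      obtain b i j c k l where uv: "u = (b, i, j)" "v = (c, k, l)"
        by (cases u, cases v)
      with arc show ?case by (cases b; cases c) (auto simp: r_def)
    qed
  qed
  moreover have "dominating ?H ?A"
    unfolding dominating_def
  proof (intro conjI ballI sub)
    fix v assume "v \<in> pverts ?H"
    then obtain b :: bool and i j :: nat where *: "i < n" "j < n" "b \<longrightarrow> i = j" "v = to_nat (b, i, j)"
      by (auto simp: clique_stars_def clique_stars_verts_def)
    have "i = j \<or> (to_nat (b, i, i), v) \<in> parcs ?H"
      using * by (cases b) (auto simp: clique_stars_def)
    moreover have "to_nat (b, i, i) \<in> ?A"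
      using * by simp
    ultimately show "v \<in> ?A \<or> (\<exists>u\<in>?A. (u, v) \<in> parcs ?H)"
      using * by blast
  qed
  ultimately have "gamma_wcon ?H \<le> card ?A"
    by (intro gamma_wcon_le pair_graph_clique_stars)
  then show ?thesis
    using card_diagonal_le[of n] by simp
qed

section \<open>Quadratic lower bound for the prism over the clique with stars\<close>

definition clique_stars_perm :: "nat \<Rightarrow> nat \<Rightarrow> nat" where
  "clique_stars_perm n = coded_perm (clique_stars_verts n) (\<lambda>(b, i, j). (b, j, i))"

lemma clique_stars_perm_permutes: "clique_stars_perm n permutes pverts (clique_stars n)"
  unfolding clique_stars_perm_def clique_stars_def pverts_coded_graph
  by (rule coded_perm_permutes) auto

lemma clique_stars_perm_to_nat [simp]:
  "i < n \<Longrightarrow> j < n \<Longrightarrow> (b \<longrightarrow> i = j) \<Longrightarrow>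
     clique_stars_perm n (to_nat (b, i, j)) = to_nat (b, j, i)"
  by (simp add: clique_stars_perm_def)

lemma clique_stars_nbr_leaf:
  assumes "(u, to_nat (False, i :: nat, j :: nat)) \<in> parcs (clique_stars n)" "i \<noteq> j"
  shows "u = to_nat (False, i, i)"
proof -
  obtain b :: bool and k l :: nat where u: "u = to_nat (b, k, l)"
    using assms(1) by (auto simp: clique_stars_def parcs_coded_graph)
  show ?thesis
    using assms unfolding u by (cases b) (auto simp: clique_stars_def)
qed

lemma clique_stars_nbr_hub:
  assumes "(to_nat (False, i :: nat, i), u) \<in> parcs (clique_stars n)"
  shows "(\<exists>j. j \<noteq> i \<and> u = to_nat (False, i, j)) \<or> u = to_nat (True, i, i)"
proof -
  obtain b :: bool and k l :: nat where u: "u = to_nat (b, k, l)"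
    using assms(1) by (auto simp: clique_stars_def parcs_coded_graph)
  show ?thesis
    using assms unfolding u by (cases b) (auto simp: clique_stars_def)
qed

text \<open>Transposing the indices fixes centres and clique vertices, so only leaves give new
  connections between the layers: l_ij is matched with the copy of l_ji. Taking \<open>i\<close> and
  \<open>j\<close> from different halves of the index range keeps them distinct and leaves
  \<open>m * m\<close> pairs.\<close>

lemma prism_clique_stars_lower:
  assumes A: "dominating (prism_graph (clique_stars (2 * m)) (clique_stars_perm (2 * m))) A"
    "weakly_convex (prism_graph (clique_stars (2 * m)) (clique_stars_perm (2 * m))) A"
  shows "m * m \<le> card A"
proof -
  let ?H = "clique_stars (2 * m)"
  let ?\<sigma> = "clique_stars_perm (2 * m)"
  let ?P = "prism_graph ?H ?\<sigma>"
  note P = pair_graph_prism_graph[OF pair_graph_clique_stars clique_stars_perm_permutes]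
  interpret P: pair_graph ?P by (rule P)
  let ?x = "\<lambda>(i :: nat) (j :: nat). to_nat (False, i, j) :: nat"
  \<comment> \<open>These are the inner vertices of the path h_i - l_ij - l_ji' - h_j'. Either one
    determines the pair, whence disjointness.\<close>
  define S where "S = (\<lambda>(i, j). {Inl (?x i j) :: nat + nat, Inr (?x j i)})"
  have "finite A"
    using A(1) P.pair_finite_verts finite_subset by (metis dominating_def)
  moreover have "S p \<inter> A \<noteq> {}" if "p \<in> {..<m} \<times> {m..<2 * m}" for p
  proof
    obtain i j where p: "p = (i, j)" by (cases p)
    have ij: "i < 2 * m" "j < 2 * m" "i \<noteq> j" using that p by auto
    have verts: "?x i j \<in> pverts ?H" "?x j i \<in> pverts ?H" "?x i i \<in> pverts ?H" "?x j j \<in> pverts ?H"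
      using ij by (auto simp: clique_stars_def)
    assume "S p \<inter> A = {}"
    then have none: "Inl (?x i j) \<notin> A" "Inr (?x j i) \<notin> A"
      by (auto simp: S_def p)
    \<comment> \<open>Injectivity identifies the left partner of a right vertex, which the prism
      arcs give only through its image.\<close>
    have \<sigma>_inv: "u = ?x l k" if "?\<sigma> u = ?x k l" "k < 2 * m" "l < 2 * m" for u k l
    proof -
      have "?\<sigma> u = ?\<sigma> (?x l k)" using that by simp
      then show ?thesis
        using permutes_inj[OF clique_stars_perm_permutes] by (rule injD[rotated])
    qed
    \<comment> \<open>The leaf l_ij has just two neighbours, its centre and its partner l_ji', and
      the partner is outside \<open>A\<close>. The same reasoning at l_ji' yields h_j'
      below.\<close>
    have "Inl (?x i i) \<in> A"
    proof -
      obtain u where u: "u \<in> A" "(u, Inl (?x i j)) \<in> parcs ?P"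
        using A(1) none verts by (auto simp: dominating_def)
      then show ?thesis
        using none ij by (cases u) (auto dest: clique_stars_nbr_leaf)
    qed
    moreover have "Inr (?x j j) \<in> A"
    proof -
      obtain u where u: "u \<in> A" "(u, Inr (?x j i)) \<in> parcs ?P"
        using A(1) none verts by (fastforce simp: dominating_def)
      show ?thesis
      proof (cases u)
        case (Inl a)
        then have "a = ?x i j" using u(2) ij \<sigma>_inv[of a j i] by simp
        then show ?thesis using u(1) none Inl by simp
      next
        case (Inr a)
        then show ?thesis using u ij by (auto dest: clique_stars_nbr_leaf)
      qed
    qed
    moreover have nbr_i: "(\<exists>l. l \<noteq> i \<and> x = Inl (?x i l)) \<or> x = Inl (to_nat (True, i, i)) \<or> x = Inr (?x i i)"
      if "(Inl (?x i i), x) \<in> parcs ?P" for x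
      using that ij by (cases x) (auto dest: clique_stars_nbr_hub)
    have nbr_j: "(\<exists>l. l \<noteq> j \<and> x = Inr (?x j l)) \<or> x = Inr (to_nat (True, j, j)) \<or> x = Inl (?x j j)"
      if "(x, Inr (?x j j)) \<in> parcs ?P" for x
    proof (cases x)
      case (Inl a)
      then have "?\<sigma> a = ?x j j" using that by auto
      then show ?thesis using \<sigma>_inv[of a j j] ij Inl by simp
    next
      case (Inr a)
      then have "(?x j j, a) \<in> parcs ?H"
        using P.arcs_symmetric[OF that] by simp
      then show ?thesis
        using Inr by (auto dest: clique_stars_nbr_hub)
    qed
    ultimately have "\<exists>x\<in>A. \<exists>y\<in>A. (Inl (?x i i), x) \<in> parcs ?P \<and> (x, y) \<in> parcs ?P
        \<and> (y, Inr (?x j j)) \<in> parcs ?P"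
    proof (intro weakly_convex_distance3[OF P A(2)])
      show "(Inl (?x i i), Inl (?x i j)) \<in> parcs ?P" "(Inl (?x i j), Inr (?x j i)) \<in> parcs ?P"
        "(Inr (?x j i), Inr (?x j j)) \<in> parcs ?P"
        using ij verts by (auto simp: clique_stars_def)
      show "(Inl (?x i i), Inr (?x j j)) \<notin> parcs ?P"
        using ij by auto
      \<comment> \<open>All neighbours of h_i carry the first index \<open>i\<close> and all
        neighbours of h_j' the first index \<open>j\<close>, so none is shared.\<close>
      show "(x, Inr (?x j j)) \<notin> parcs ?P" if "(Inl (?x i i), x) \<in> parcs ?P" for x
        using nbr_i[OF that] nbr_j[of x] ij by auto
    qed auto
    then obtain x y where xy: "x \<in> A" "y \<in> A" "(Inl (?x i i), x) \<in> parcs ?P" "(x, y) \<in> parcs ?P"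
      "(y, Inr (?x j j)) \<in> parcs ?P" by blast
    \<comment> \<open>Among the neighbours of h_i and of h_j', the only adjacent pair is l_ij and
      l_ji'.\<close>
    show False
      using nbr_i[OF xy(3)] nbr_j[OF xy(5)] xy(1,2,4) none ij
      by (auto simp: clique_stars_def)
  qed
  moreover have "p = q"
    if "p \<in> {..<m} \<times> {m..<2 * m}" "q \<in> {..<m} \<times> {m..<2 * m}" "S p \<inter> S q \<noteq> {}" for p q
    using that by (auto simp: S_def)
  ultimately have "card ({..<m} \<times> {m..<2 * m}) \<le> card A"
    by (rule card_le_if_meets_disjoint)
  then show ?thesis by simp
qed

theorem mainTheorem2:
  fixes k :: nat
  shows "\<exists>(G :: nat pair_pre_digraph) (H :: nat pair_pre_digraph) \<pi> \<sigma>.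
     pair_graph G \<and> Digraph_Component.connected (with_proj G) \<and>
     pair_graph H \<and> Digraph_Component.connected (with_proj H) \<and>
     \<pi> permutes pverts G \<and> \<sigma> permutes pverts H \<and>
     int (gamma_wcon G) - int (gamma_wcon (prism_graph G \<pi>)) \<ge> int k \<and>
     int (gamma_wcon (prism_graph H \<sigma>)) - 2 * int (gamma_wcon H) \<ge> int k"
proof -
  \<comment> \<open>With \<open>2 * m\<close> indices, the upper bound \<open>4 * n\<close> for the
    first prism and twice the bound \<open>2 * n\<close> for the second graph both equal
    \<open>8 * m\<close>. The value \<open>k + 8\<close> makes \<open>m * m\<close> exceed this by
    \<open>k * m\<close>, which is at least \<open>k\<close>.\<close>
  define m where "m = k + 8"
  let ?G = "hub_clique (2 * m)" and ?\<pi> = "hub_clique_perm (2 * m)"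
  let ?H = "clique_stars (2 * m)" and ?\<sigma> = "clique_stars_perm (2 * m)"
  have pos: "0 < 2 * m" by (simp add: m_def)
  have "m * m = k * m + 8 * m" by (simp add: m_def algebra_simps)
  moreover have "k \<le> k * m" by (simp add: m_def)
  ultimately have mm: "k + 8 * m \<le> m * m" by linarith
  have "m * m \<le> gamma_wcon ?G"
    by (rule le_gamma_wcon[OF pair_graph_hub_clique connected_hub_clique[OF pos] hub_clique_lower])
  then have "int k \<le> int (gamma_wcon ?G) - int (gamma_wcon (prism_graph ?G ?\<pi>))"
    using mm gamma_wcon_prism_hub_clique[OF pos] by linarith
  moreover have "m * m \<le> gamma_wcon (prism_graph ?H ?\<sigma>)"
    by (rule le_gamma_wcon[OF pair_graph_prism_graph connected_prism_graph prism_clique_stars_lower])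
      (auto intro: pair_graph_clique_stars connected_clique_stars[OF pos] clique_stars_perm_permutes)
  then have "int k \<le> int (gamma_wcon (prism_graph ?H ?\<sigma>)) - 2 * int (gamma_wcon ?H)"
    using mm gamma_wcon_clique_stars[OF pos] by linarith
  ultimately show ?thesis
    using pair_graph_hub_clique connected_hub_clique[OF pos] pair_graph_clique_stars
      connected_clique_stars[OF pos] hub_clique_perm_permutes clique_stars_perm_permutes
    by blast
qed

end
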